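(* Let $n\ge 1$ and let $\Phi$ be the root system of type $B_n$. (1) The biclosed sets in $\Phi$ are in bijection with the quasitrivial semigroup structures of type $B_n$. (2) Let $C$ be a biclosed set in $\Phi$ and let $F_C$ be the corresponding quasitrivial associative binary operation on $\{\pm1,\pm2,\dots,\pm n\}$. Let $t,m\in\{\pm1,\dots,\pm n\}$ with $t<m$. Then: (a) $\{\alpha_{t,m},-\alpha_{t,m}\}\cap C=\emptyset$ if and only if $F_C(t,m)=t$, $F_C(m,t)=m$. (b) $\alpha_{t,m}\in C$ and $-\alpha_{t,m}\notin C$ if and only if $F_C(t,m)=F_C(m,t)=m$. (c) $-\alpha_{t,m}\in C$ and $\alpha_{t,m}\notin C$ if and only if $F_C(t,m)=F_C(m,t)=t$. (d) $\{\alpha_{t,m},-\alpha_{t,m}\}\subset C$ if and only if $F_C(t,m)=m$, $F_C(m,t)=t$. That is, there is a bijection $C\mapsto F_C$ from the set of biclosed sets in $\Phi$ to the set of quasitrivial semigroup structures of type $B_n$ for which (a)–(d) hold.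
   Context: Root system of type $B_n$: $V$ is a real vector space with basis $\alpha_1,\dots,\alpha_n$ ($\alpha_1$ the short simple root), and $$\Phi=\{\pm(\alpha_i+\cdots+\alpha_k):1\le i\le k\le n\}\cup\{\pm(2\alpha_1+\cdots+2\alpha_k+\alpha_{k+1}+\cdots+\alpha_p):1\le k<p\le n\}.$$ Labelling of roots: for $1\le a<b\le n$, $\alpha_{a,b}=\alpha_{a+1}+\alpha_{a+2}+\cdots+\alpha_b$ and $\alpha_{-a,b}=2\alpha_1+\cdots+2\alpha_a+\alpha_{a+1}+\cdots+\alpha_b$; for $1\le a\le n$, $\alpha_{-a,a}=\alpha_1+\cdots+\alpha_a$. This is extended to all pairs of distinct elements of $\{\pm1,\dots,\pm n\}$ by $\alpha_{r,s}=-\alpha_{s,r}$ and $\alpha_{-r,-s}=-\alpha_{r,s}$. A subset $C\subset\Phi$ is closed if $\alpha,\beta\in C$ and $\alpha+\beta\in\Phi$ imply $\alpha+\beta\in C$; it is biclosed in $\Phi$ if $C$ and $\Phi\setminus C$ are closed. A quasitrivial semigroup structure on a set $X$ is an associative $F:X\times X\to X$ with $F(a,b)\in\{a,b\}$ for all $a,b$. It is known that such an $F$ is equivalent to a total preorder $\precsim$ on $X$ such that $F(x,y)$ is the $\precsim$-maximum of $x,y$ when $x\nsim y$, and such that on each equivalence class $F$ restricts to one of the projections $\pi_1,\pi_2$, where $\pi_i(a_1,a_2)=a_i$ (here $x\sim y$ iff $x\precsim y$ and $y\precsim x$). A total preorder on $\{\pm1,\dots,\pm n\}$ is admissible if: (1)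 every equivalence class $B$ satisfies $B=-B$ or $B\cap-B=\emptyset$; (2) if $B$ is an equivalence class, so is $-B$; (3) if $A,B$ are equivalence classes with $A\prec B$, then $-B\prec-A$. A quasitrivial semigroup structure $F$ on $\{\pm1,\dots,\pm n\}$ is of type $B_n$ if its associated total preorder is admissible and for every equivalence class $B$ there is $i\in\{1,2\}$ with $F|_B=\pi_i$ and $F|_{-B}=\pi_i$ (the same $i$ for $B$ and $-B$). *)

theory Defs
  imports Complex_Main "HOL-Library.FuncSet"
begin

section \<open>The root system of type B\<close>

definition roots_B :: "(nat \<Rightarrow> 'v::real_vector) \<Rightarrow> nat \<Rightarrow> 'v set" where
  "roots_B \<alpha> n =
     {x. \<exists>i k. 1 \<le> i \<and> i \<le> k \<and> k \<le> n \<and>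
        (x = (\<Sum>j=i..k. \<alpha> j) \<or> x = - (\<Sum>j=i..k. \<alpha> j))} \<union>
     {x. \<exists>k p. 1 \<le> k \<and> k < p \<and> p \<le> n \<and>
        (x = (\<Sum>j=1..k. 2 *\<^sub>R \<alpha> j) + (\<Sum>j=k+1..p. \<alpha> j) \<or>
         x = - ((\<Sum>j=1..k. 2 *\<^sub>R \<alpha> j) + (\<Sum>j=k+1..p. \<alpha> j)))}"

definition signed_indices :: "nat \<Rightarrow> int set" where
  "signed_indices n = {1..int n} \<union> uminus ` {1..int n}"

text \<open>The labels that are given by an explicit formula, that is, the pairs \<open>(r, s)\<close>
  with \<open>s > 0\<close>, \<open>\<bar>r\<bar> \<le> s\<close> and \<open>r \<noteq> s\<close>; the values elsewhere are irrelevant.\<close>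

definition basic_label :: "(nat \<Rightarrow> 'v::real_vector) \<Rightarrow> int \<Rightarrow> int \<Rightarrow> 'v" where
  "basic_label \<alpha> r s =
     (if 0 < r then \<Sum>j=nat r + 1..nat s. \<alpha> j
      else if r = - s then \<Sum>j=1..nat s. \<alpha> j
      else (\<Sum>j=1..nat (- r). 2 *\<^sub>R \<alpha> j) + (\<Sum>j=nat (- r) + 1..nat s. \<alpha> j))"

text \<open>The extension to all pairs of distinct indices. The four cases are \<open>(r, s)\<close>,
  \<open>(- r, - s)\<close>, \<open>(s, r)\<close> and \<open>(- s, - r)\<close> being a pair of the above kind. The lemmas below
  show that the two rules that define the extension hold.\<close>

definition root_label :: "(nat \<Rightarrow> 'v::real_vector) \<Rightarrow> int \<Rightarrow> int \<Rightarrow> 'v" where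
  "root_label \<alpha> r s =
     (if \<bar>r\<bar> \<le> \<bar>s\<bar>
      then (if 0 < s then basic_label \<alpha> r s else - basic_label \<alpha> (- r) (- s))
      else (if 0 < r then - basic_label \<alpha> s r else basic_label \<alpha> (- s) (- r)))"

lemma root_label_pos:
  assumes "1 \<le> a" "a < b"
  shows "root_label \<alpha> (int a) (int b) = (\<Sum>j=a+1..b. \<alpha> j)"
  using assms by (simp add: root_label_def basic_label_def nat_add_distrib)

lemma root_label_neg_pos:
  assumes "1 \<le> a" "a < b"
  shows "root_label \<alpha> (- int a) (int b) = (\<Sum>j=1..a. 2 *\<^sub>R \<alpha> j) + (\<Sum>j=a+1..b. \<alpha> j)"
  using assms by (simp add: root_label_def basic_label_def nat_add_distrib)

lemma root_label_short:
  assumes "1 \<le> a"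
  shows "root_label \<alpha> (- int a) (int a) = (\<Sum>j=1..a. \<alpha> j)"
  using assms by (simp add: root_label_def basic_label_def)

lemma root_label_swap:
  assumes "r \<noteq> 0" "s \<noteq> 0" "r \<noteq> s"
  shows "root_label \<alpha> r s = - root_label \<alpha> s r"
proof (cases "r = - s")
  case True
  then show ?thesis using assms by (auto simp: root_label_def)
next
  case False
  then show ?thesis using assms by (auto simp: root_label_def)
qed

lemma root_label_uminus:
  assumes "r \<noteq> 0" "s \<noteq> 0" "r \<noteq> s"
  shows "root_label \<alpha> (- r) (- s) = - root_label \<alpha> r s"
  using assms by (auto simp: root_label_def)

definition closed_roots :: "'v::real_vector set \<Rightarrow> 'v set \<Rightarrow> bool" where
  "closed_roots \<Phi> C \<longleftrightarrow>
     C \<subseteq> \<Phi> \<and> (\<forall>x\<in>C. \<forall>y\<in>C. x + y \<in> \<Phi> \<longrightarrow> x + y \<in> C)"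

definition biclosed_roots :: "'v::real_vector set \<Rightarrow> 'v set \<Rightarrow> bool" where
  "biclosed_roots \<Phi> C \<longleftrightarrow> closed_roots \<Phi> C \<and> closed_roots \<Phi> (\<Phi> - C)"

section \<open>Quasitrivial semigroups\<close>

text \<open>Binary operations on \<open>X\<close> are extensional functions on \<open>X \<times> X\<close>, so that distinct
  functions are distinct operations.\<close>

definition quasitrivial_semigroup :: "'a set \<Rightarrow> ('a \<times> 'a \<Rightarrow> 'a) \<Rightarrow> bool" where
  "quasitrivial_semigroup X F \<longleftrightarrow>
     F \<in> X \<times> X \<rightarrow>\<^sub>E X \<and>
     (\<forall>a\<in>X. \<forall>b\<in>X. \<forall>c\<in>X. F (F (a, b), c) = F (a, F (b, c))) \<and>
     (\<forall>a\<in>X. \<forall>b\<in>X. F (a, b) \<in> {a, b})"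

definition total_preorder_on :: "'a set \<Rightarrow> ('a \<times> 'a) set \<Rightarrow> bool" where
  "total_preorder_on X R \<longleftrightarrow> preorder_on X R \<and> total_on X R"

definition preorder_classes :: "'a set \<Rightarrow> ('a \<times> 'a) set \<Rightarrow> 'a set set" where
  "preorder_classes X R = X // (R \<inter> R\<inverse>)"

text \<open>The projections \<open>\<pi>\<^sub>1\<close> and \<open>\<pi>\<^sub>2\<close> are \<^const>\<open>fst\<close> and \<^const>\<open>snd\<close>.\<close>

definition associated_preorder :: "'a set \<Rightarrow> ('a \<times> 'a \<Rightarrow> 'a) \<Rightarrow> ('a \<times> 'a) set \<Rightarrow> bool" where
  "associated_preorder X F R \<longleftrightarrow>
     total_preorder_on X R \<and>
     (\<forall>x\<in>X. \<forall>y\<in>X. (x, y) \<in> R \<and> (y, x) \<notin> R \<longrightarrow> F (x, y) = y \<and> F (y, x) = y) \<and>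
     (\<forall>B\<in>preorder_classes X R. \<exists>\<pi>\<in>{fst, snd}. \<forall>p\<in>B \<times> B. F p = \<pi> p)"

lemma associated_preorder_iff:
  assumes R: "associated_preorder X F R" and x: "x \<in> X" and y: "y \<in> X"
  shows "(x, y) \<in> R \<longleftrightarrow> F (x, y) = y \<or> F (y, x) = y"
proof -
  have pre: "preorder_on X R" "total_on X R"
    using R by (auto simp: associated_preorder_def total_preorder_on_def)
  have refl: "(z, z) \<in> R" if "z \<in> X" for z
    using pre that by (auto simp: preorder_on_def refl_on_def)
  show ?thesis
  proof (cases "(x, y) \<in> R \<and> (y, x) \<in> R")
    case True
    let ?B = "(R \<inter> R\<inverse>) `` {x}"
    have "?B \<in> preorder_classes X R"
      using x by (auto simp: preorder_classes_def quotient_def)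
    then obtain \<pi> where "\<pi> \<in> {fst, snd}" "\<forall>p\<in>?B \<times> ?B. F p = \<pi> p"
      using R unfolding associated_preorder_def by blast
    moreover have "x \<in> ?B" "y \<in> ?B" using True refl[OF x] by auto
    ultimately show ?thesis using True by auto
  next
    case False
    show ?thesis
    proof (cases "(x, y) \<in> R")
      case True
      then show ?thesis using False R x y by (auto simp: associated_preorder_def)
    next
      case nxy: False
      then have "x \<noteq> y" using refl x by auto
      then have "(y, x) \<in> R" using nxy pre(2) x y by (auto simp: total_on_def)
      then have "F (x, y) = x" "F (y, x) = x"
        using nxy R x y by (auto simp: associated_preorder_def)
      then show ?thesis using nxy \<open>x \<noteq> y\<close> by auto
    qed
  qed
qed

lemma associated_preorder_unique:
  assumes "associated_preorder X F R" "associated_preorder X F S"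
  shows "R = S"
proof -
  have "R \<subseteq> X \<times> X" "S \<subseteq> X \<times> X"
    using assms by (auto simp: associated_preorder_def total_preorder_on_def preorder_on_def)
  then show ?thesis
    using associated_preorder_iff[OF assms(1)] associated_preorder_iff[OF assms(2)] by auto
qed

definition admissible_preorder :: "nat \<Rightarrow> (int \<times> int) set \<Rightarrow> bool" where
  "admissible_preorder n R \<longleftrightarrow>
     (let \<B> = preorder_classes (signed_indices n) R;
          less = (\<lambda>A B. \<forall>a\<in>A. \<forall>b\<in>B. (a, b) \<in> R \<and> (b, a) \<notin> R)
      in (\<forall>B\<in>\<B>. B = uminus ` B \<or> B \<inter> uminus ` B = {}) \<and>
         (\<forall>B\<in>\<B>. uminus ` B \<in> \<B>) \<and>
         (\<forall>A\<in>\<B>. \<forall>B\<in>\<B>. less A B \<longrightarrow> less (uminus ` B) (uminus ` A)))"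

text \<open>The preorder \<open>R\<close> below is determined by \<open>F\<close>, see lemma \<open>associated_preorder_unique\<close>.\<close>

definition quasitrivial_semigroup_B :: "nat \<Rightarrow> (int \<times> int \<Rightarrow> int) \<Rightarrow> bool" where
  "quasitrivial_semigroup_B n F \<longleftrightarrow>
     quasitrivial_semigroup (signed_indices n) F \<and>
     (\<exists>R. associated_preorder (signed_indices n) F R \<and> admissible_preorder n R \<and>
        (\<forall>B\<in>preorder_classes (signed_indices n) R. \<exists>\<pi>\<in>{fst, snd}.
           (\<forall>p\<in>B \<times> B. F p = \<pi> p) \<and>
           (\<forall>p\<in>(uminus ` B) \<times> (uminus ` B). F p = \<pi> p)))"

end

theory Submission imports Defs begin

text \<open>A quasitrivial operation is the relation \<open>P x y \<longleftrightarrow> F (x, y) = y\<close>, and associativity says that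
  both \<open>P\<close> and its complement are transitive on distinct triples. The associated preorder is
  admissible with matching projections exactly when \<open>P x y \<longleftrightarrow> P (- y) (- x)\<close>, which is also the
  only coincidence among the labels \<open>\<alpha>\<^sub>x\<^sub>,\<^sub>y\<close>. Hence type B operations correspond to sets of roots
  \<open>C\<close> via \<open>P x y \<longleftrightarrow> \<alpha>\<^sub>x\<^sub>,\<^sub>y \<in> C\<close>, with transitivity of \<open>P\<close> and of its complement turning into closedness
  of \<open>C\<close> and of its complement. With \<open>e\<^sub>a = \<alpha>\<^sub>1 + \<dots> + \<alpha>\<^sub>a\<close> and \<open>e\<^sub>-\<^sub>a = - e\<^sub>a\<close> one has
  \<open>\<alpha>\<^sub>x\<^sub>,\<^sub>y = e\<^sub>y - e\<^sub>x\<close>, except for the short roots \<open>\<alpha>\<^sub>-\<^sub>y\<^sub>,\<^sub>y = e\<^sub>y\<close>; because of these, the two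
  transitivity conditions match the two closedness conditions only jointly.\<close>

section \<open>Quasitrivial semigroups as relations\<close>

text \<open>Equal entries are left out because idempotence forces \<open>P x x\<close>: on a triple
  \<open>x, y, x\<close> the complement of \<open>P\<close> could not be transitive once
  \<open>P x y\<close> and \<open>P y x\<close> both fail.\<close>

definition trans_on_distinct :: "'a set \<Rightarrow> ('a \<Rightarrow> 'a \<Rightarrow> bool) \<Rightarrow> bool" where
  "trans_on_distinct X P \<longleftrightarrow>
     (\<forall>x\<in>X. \<forall>y\<in>X. \<forall>z\<in>X. x \<noteq> y \<longrightarrow> y \<noteq> z \<longrightarrow> x \<noteq> z \<longrightarrow> P x y \<longrightarrow> P y z \<longrightarrow> P x z)"

definition bitrans_on_distinct :: "'a set \<Rightarrow> ('a \<Rightarrow> 'a \<Rightarrow> bool) \<Rightarrow> bool" where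
  "bitrans_on_distinct X P \<longleftrightarrow>
     trans_on_distinct X P \<and> trans_on_distinct X (\<lambda>x y. \<not> P x y)"

lemma trans_on_distinctD:
  assumes "trans_on_distinct X P" "P x y" "P y z" "x \<in> X" "y \<in> X" "z \<in> X" "x \<noteq> y" "y \<noteq> z" "x \<noteq> z"
  shows "P x z"
  using assms unfolding trans_on_distinct_def by blast

lemma bitrans_on_distinct_cong:
  assumes "\<And>x y. x \<in> X \<Longrightarrow> y \<in> X \<Longrightarrow> x \<noteq> y \<Longrightarrow> P x y \<longleftrightarrow> P' x y"
  shows "bitrans_on_distinct X P \<longleftrightarrow> bitrans_on_distinct X P'"
  unfolding bitrans_on_distinct_def trans_on_distinct_def using assms by (smt (verit))

text \<open>If two of \<open>a\<close>, \<open>b\<close>, \<open>c\<close> coincide, associativity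
  follows from \<open>F (x, y) \<in> {x, y}\<close>. For distinct entries the two bracketings agree
  automatically when exactly one of \<open>P a b\<close>, \<open>P b c\<close> holds. If both hold,
  they are \<open>c\<close> and \<open>F (a, c)\<close>; if neither holds, they are
  \<open>F (a, c)\<close> and \<open>a\<close>.\<close>

lemma quasitrivial_semigroup_iff:
  "quasitrivial_semigroup X F \<longleftrightarrow>
     F \<in> X \<times> X \<rightarrow>\<^sub>E X \<and> (\<forall>a\<in>X. \<forall>b\<in>X. F (a, b) \<in> {a, b}) \<and>
     bitrans_on_distinct X (\<lambda>x y. F (x, y) = y)"
proof (cases "\<forall>a\<in>X. \<forall>b\<in>X. F (a, b) \<in> {a, b}")
  case q: True
  have "F (F (a, b), c) = F (a, F (b, c)) \<longleftrightarrow>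
      (a \<noteq> b \<longrightarrow> b \<noteq> c \<longrightarrow> a \<noteq> c \<longrightarrow>
        (F (a, b) = b \<longrightarrow> F (b, c) = c \<longrightarrow> F (a, c) = c) \<and>
        (F (a, b) \<noteq> b \<longrightarrow> F (b, c) \<noteq> c \<longrightarrow> F (a, c) \<noteq> c))"
    if "a \<in> X" "b \<in> X" "c \<in> X" for a b c
  proof -
    have "F (x, y) = x \<or> F (x, y) = y" if "x \<in> {a, b, c}" "y \<in> {a, b, c}" for x y
      using q that \<open>a \<in> X\<close> \<open>b \<in> X\<close> \<open>c \<in> X\<close> by blast
    then show ?thesis by (smt (verit) insertCI)
  qed
  with q show ?thesis
    unfolding quasitrivial_semigroup_def bitrans_on_distinct_def trans_on_distinct_def
    by (smt (verit, best))
next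
  case False
  then show ?thesis unfolding quasitrivial_semigroup_def by blast
qed

section \<open>The total preorder of a quasitrivial semigroup\<close>

definition semigroup_preorder :: "'a set \<Rightarrow> ('a \<times> 'a \<Rightarrow> 'a) \<Rightarrow> ('a \<times> 'a) set" where
  "semigroup_preorder X F = {(x, y). x \<in> X \<and> y \<in> X \<and> (F (x, y) = y \<or> F (y, x) = y)}"

text \<open>By \<open>associated_preorder_iff\<close> no other relation can be associated with
  \<open>F\<close>. That this one is, comes from the two transitivity properties of
  \<open>P\<close>.\<close>

lemma associated_preorder_semigroup_preorder:
  assumes "quasitrivial_semigroup X F"
  shows "associated_preorder X F (semigroup_preorder X F)"
proof -
  let ?R = "semigroup_preorder X F"
  have q: "F (a, b) = a \<or> F (a, b) = b" if "a \<in> X" "b \<in> X" for a b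
    using assms that unfolding quasitrivial_semigroup_def by blast
  have bt: "bitrans_on_distinct X (\<lambda>x y. F (x, y) = y)"
    using assms unfolding quasitrivial_semigroup_iff by blast
  have t1: "F (x, z) = z" if "F (x, y) = y" "F (y, z) = z" "x \<in> X" "y \<in> X" "z \<in> X" for x y z
    using trans_on_distinctD[of X "\<lambda>x y. F (x, y) = y" x y z] bt q[of x x] that
    by (auto simp: bitrans_on_distinct_def)
  have t2: "F (x, z) = x" if "F (x, y) = x" "F (y, z) = y" "x \<in> X" "y \<in> X" "z \<in> X" for x y z
    using trans_on_distinctD[of X "\<lambda>x y. F (x, y) \<noteq> y" x y z] bt q[of x x] q[of x z] that
    by (auto simp: bitrans_on_distinct_def)
  have mem: "(x, y) \<in> ?R \<longleftrightarrow> F (x, y) = y \<or> F (y, x) = y" if "x \<in> X" "y \<in> X" for x y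
    using that by (simp add: semigroup_preorder_def)
  have "refl_on X ?R" using q by (auto simp: refl_on_def semigroup_preorder_def)
  moreover have "trans ?R"
  proof (rule transI)
    fix x y z assume xy: "(x, y) \<in> ?R" and yz: "(y, z) \<in> ?R"
    then have X: "x \<in> X" "y \<in> X" "z \<in> X" by (auto simp: semigroup_preorder_def)
    show "(x, z) \<in> ?R"
    \<comment> \<open>Each of the two hypotheses is an instance of \<open>P\<close> or of its
      complement on the reversed pair. Two of the same kind chain to contradict
      \<open>F (x, z) = x\<close> or \<open>F (z, x) = x\<close>; in the mixed cases
      \<open>P z x\<close> is chained with the instance of \<open>P\<close> and contradicts the
      other one.\<close>
    proof (rule ccontr)
      assume "(x, z) \<notin> ?R"
      then have "F (x, z) = x" "F (z, x) = x" "x \<noteq> z" using mem q X by metis+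
      then show False using xy yz mem q t1 t2 X by metis
    qed
  qed
  moreover have "?R \<subseteq> X \<times> X" by (auto simp: semigroup_preorder_def)
  moreover have "total_on X ?R" using q by (auto simp: total_on_def semigroup_preorder_def)
  ultimately have tp: "total_preorder_on X ?R"
    by (simp add: total_preorder_on_def preorder_on_def)
  have mx: "F (x, y) = y \<and> F (y, x) = y" if "x \<in> X" "y \<in> X" "(y, x) \<notin> ?R" for x y
    using that mem q by metis
  have cls: "\<exists>\<pi>\<in>{fst, snd}. \<forall>p\<in>B \<times> B. F p = \<pi> p" if B: "B \<in> preorder_classes X ?R" for B
  proof -
    obtain a where a: "a \<in> X" "B = (?R \<inter> ?R\<inverse>) `` {a}"
      using B by (auto simp: preorder_classes_def quotient_def)
    have BX: "x \<in> X" if "x \<in> B" for x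
      using that a by (auto simp: semigroup_preorder_def)
    have eqv: "(x, y) \<in> ?R" if "x \<in> B" "y \<in> B" for x y
      using that a \<open>trans ?R\<close> by (auto dest: transD)
    have sym: "F (y, x) = x" if "F (x, y) = y" "x \<in> B" "y \<in> B" for x y
      using that mem[of x y] mem[of y x] eqv[of x y] eqv[of y x] BX by auto
    show ?thesis
    proof (cases "\<forall>x\<in>B. \<forall>y\<in>B. F (x, y) = x")
      case True
      then show ?thesis by auto
    next
      case False
      then obtain x y where xy: "x \<in> B" "y \<in> B" "F (x, y) = y" "x \<noteq> y" using q BX by metis
      \<comment> \<open>Inside a class \<open>P\<close> is symmetric. If \<open>P u w\<close>
        failed, then so would \<open>P v w\<close>, hence \<open>P w v\<close>, and transitivity of
        the complement along \<open>u, w, v\<close> would refute \<open>P u v\<close>. So a single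
        nontrivial instance of \<open>P\<close> spreads over the whole class.\<close>
      have step: "F (u, w) = w"
        if "F (u, v) = v" "u \<noteq> v" "u \<in> B" "v \<in> B" "w \<in> B" for u v w
      proof (rule ccontr)
        assume uw: "F (u, w) \<noteq> w"
        then have u: "F (u, w) = u" using q[of u w] BX that by blast
        have "F (v, w) \<noteq> w" using t1[of u v w] uw BX that by blast
        moreover have "F (w, v) = v \<Longrightarrow> F (v, w) = w" using sym[of w v] that by blast
        ultimately have "F (w, v) = w" using q[of w v] BX that by blast
        then show False using t2[of u w v] u that BX by simp
      qed
      have "F (u, w) = w" if "u \<in> B" "w \<in> B" for u w
      proof (cases "u = x")
        case True
        then show ?thesis using step[of x y w] xy that by blast
      next
        case False
        have "F (x, u) = u" using step[of x y u] xy that by blast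
        then have "F (u, x) = x" using sym[of x u] xy that by blast
        then show ?thesis using step[of u x w] False xy that by blast
      qed
      then show ?thesis by auto
    qed
  qed
  from tp mx cls show ?thesis unfolding associated_preorder_def by blast
qed

section \<open>Type B in terms of the relation\<close>

lemma uminus_signed_indices [simp]: "- x \<in> signed_indices n \<longleftrightarrow> x \<in> signed_indices n"
  by (auto simp: signed_indices_def image_iff)

text \<open>For equivalent \<open>x\<close> and \<open>y\<close> the symmetry expresses that a class
  and its negative carry the same projection; for strictly comparable ones it is condition (3).
  Conversely, applying the implication to the negated pair makes it an equivalence, so negation
  reverses the preorder and maps classes to classes.\<close>

lemma quasitrivial_semigroup_B_iff:
  "quasitrivial_semigroup_B n F \<longleftrightarrow>
     quasitrivial_semigroup (signed_indices n) F \<and>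
     (\<forall>x\<in>signed_indices n. \<forall>y\<in>signed_indices n.
        x \<noteq> y \<longrightarrow> F (x, y) = y \<longrightarrow> F (- y, - x) = - x)"
  (is "_ \<longleftrightarrow> ?qs \<and> ?sym")
proof (intro iffI conjI)
  let ?I = "signed_indices n"
  assume B: "quasitrivial_semigroup_B n F"
  then show ?qs by (simp add: quasitrivial_semigroup_B_def)
  obtain R where R: "associated_preorder ?I F R" and ad: "admissible_preorder n R"
    and pr: "\<And>B. B \<in> preorder_classes ?I R \<Longrightarrow> \<exists>\<pi>\<in>{fst, snd}. (\<forall>p\<in>B \<times> B. F p = \<pi> p) \<and>
           (\<forall>p\<in>(uminus ` B) \<times> (uminus ` B). F p = \<pi> p)"
    using B unfolding quasitrivial_semigroup_B_def by blast
  have pre: "refl_on ?I R" "trans R" "R \<subseteq> ?I \<times> ?I" "total_on ?I R"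
    using R by (auto simp: associated_preorder_def total_preorder_on_def preorder_on_def)
  have q: "F (a, b) = a \<or> F (a, b) = b" if "a \<in> ?I" "b \<in> ?I" for a b
    using \<open>?qs\<close> that unfolding quasitrivial_semigroup_def by blast
  let ?c = "\<lambda>x. (R \<inter> R\<inverse>) `` {x}"
  have c: "?c x \<in> preorder_classes ?I R" "x \<in> ?c x" if "x \<in> ?I" for x
    using that pre(1) by (auto simp: preorder_classes_def quotient_def refl_on_def)
  show ?sym
  proof (intro ballI impI)
    fix x y assume xy: "x \<in> ?I" "y \<in> ?I" "x \<noteq> y" "F (x, y) = y"
    then have Rxy: "(x, y) \<in> R" using associated_preorder_iff[OF R] by blast
    show "F (- y, - x) = - x"
    proof (cases "(y, x) \<in> R")
      case True
      then have "y \<in> ?c x" using Rxy by auto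
      with c(2)[OF xy(1)] pr[OF c(1)[OF xy(1)]] xy show ?thesis by fastforce
    next
      case False
      have "\<forall>a\<in>?c x. \<forall>b\<in>?c y. (a, b) \<in> R \<and> (b, a) \<notin> R"
        using Rxy False pre(2) by (auto dest: transD)
      then have "\<forall>a\<in>uminus ` ?c y. \<forall>b\<in>uminus ` ?c x. (a, b) \<in> R \<and> (b, a) \<notin> R"
        using ad c[OF xy(1)] c[OF xy(2)] unfolding admissible_preorder_def Let_def by blast
      then have "(- y, - x) \<in> R" "(- x, - y) \<notin> R" using c(2) xy by blast+
      then show ?thesis using R xy unfolding associated_preorder_def by simp
    qed
  qed
next
  let ?I = "signed_indices n" and ?R = "semigroup_preorder (signed_indices n) F"
  assume asm: "?qs \<and> ?sym"
  then have sym: "F (- y, - x) = - x" if "x \<in> ?I" "y \<in> ?I" "x \<noteq> y" "F (x, y) = y" for x y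
    using that by blast
  have q: "F (a, b) = a \<or> F (a, b) = b" if "a \<in> ?I" "b \<in> ?I" for a b
    using asm that unfolding quasitrivial_semigroup_def by blast
  have R: "associated_preorder ?I F ?R"
    using asm associated_preorder_semigroup_preorder by blast
  have pre: "refl_on ?I ?R" "trans ?R" "?R \<subseteq> ?I \<times> ?I" "total_on ?I ?R"
    using R by (auto simp: associated_preorder_def total_preorder_on_def preorder_on_def)
  have neg: "(- y, - x) \<in> ?R" if "(x, y) \<in> ?R" for x y
  proof -
    have X: "x \<in> ?I" "y \<in> ?I" using that by (auto simp: semigroup_preorder_def)
    have "F (- y, - x) = - x \<or> F (- x, - y) = - x"
    proof (cases "x = y")
      case True
      then show ?thesis using q[of "- x" "- x"] X by simp
    next
      case False
      show ?thesis
      proof (rule ccontr)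
        \<comment> \<open>Both values are then \<open>- y\<close>. The symmetry at
          \<open>(x, y)\<close> and at \<open>(- x, - y)\<close> turns this into \<open>y\<close>
          lying strictly below \<open>x\<close>.\<close>
        assume "\<not> ?thesis"
        then have "F (- y, - x) = - y" "F (- x, - y) = - y"
          using q[of "- x" "- y"] q[of "- y" "- x"] X by auto
        then have "F (x, y) \<noteq> y" "F (y, x) = x"
          using sym[of x y] sym[of "- x" "- y"] X False by auto
        then show False using that False by (auto simp: semigroup_preorder_def)
      qed
    qed
    then show ?thesis using X by (simp add: semigroup_preorder_def)
  qed
  let ?c = "\<lambda>x. (?R \<inter> ?R\<inverse>) `` {x}"
  have cls: "\<exists>x\<in>?I. B = ?c x" if "B \<in> preorder_classes ?I ?R" for B
    using that by (auto simp: preorder_classes_def quotient_def)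
  have c: "?c x \<in> preorder_classes ?I ?R" "x \<in> ?c x" if "x \<in> ?I" for x
    using that pre(1) by (auto simp: preorder_classes_def quotient_def refl_on_def)
  have neg_c: "uminus ` ?c x = ?c (- x)" if "x \<in> ?I" for x
  proof (intro equalityI subsetI)
    fix y assume "y \<in> uminus ` ?c x"
    then show "y \<in> ?c (- x)" using neg by auto
  next
    fix y assume "y \<in> ?c (- x)"
    then have "- y \<in> ?c x" using neg[of "- x" y] neg[of y "- x"] by auto
    then show "y \<in> uminus ` ?c x" by (metis image_eqI minus_minus)
  qed
  have disj: "?c x = ?c y" if "z \<in> ?c x" "z \<in> ?c y" for x y z
    using that pre(2) by (auto dest: transD)
  have "admissible_preorder n ?R"
    unfolding admissible_preorder_def Let_def
  proof (intro conjI ballI impI)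
    fix B assume "B \<in> preorder_classes ?I ?R"
    then obtain x where x: "x \<in> ?I" "B = ?c x" using cls by blast
    show "B = uminus ` B \<or> B \<inter> uminus ` B = {}"
      using disj[of _ x "- x"] x neg_c by auto
    show "uminus ` B \<in> preorder_classes ?I ?R"
      using x neg_c c(1)[of "- x"] by simp
  next
    fix A B a b
    assume "\<forall>a\<in>A. \<forall>b\<in>B. (a, b) \<in> ?R \<and> (b, a) \<notin> ?R" "a \<in> uminus ` B" "b \<in> uminus ` A"
    then show "(a, b) \<in> ?R" "(b, a) \<notin> ?R"
      using neg[of "- b" "- a"] neg[of b a] by auto
  qed
  moreover have "\<exists>\<pi>\<in>{fst, snd}. (\<forall>p\<in>B \<times> B. F p = \<pi> p) \<and>
      (\<forall>p\<in>uminus ` B \<times> uminus ` B. F p = \<pi> p)" if B: "B \<in> preorder_classes ?I ?R" for B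
  proof -
    obtain \<pi> where \<pi>: "\<pi> \<in> {fst, snd}" "\<forall>p\<in>B \<times> B. F p = \<pi> p"
      using R B unfolding associated_preorder_def by blast
    have BI: "x \<in> ?I" if "x \<in> B" for x
      using that cls[OF B] by (auto simp: semigroup_preorder_def)
    have "F (- x, - y) = \<pi> (- x, - y)" if "x \<in> B" "y \<in> B" for x y
    proof (cases "x = y")
      case True
      then show ?thesis using q[of "- x" "- x"] BI that \<pi> by auto
    next
      case False
      \<comment> \<open>The pair is taken in reversed order because the symmetry sends
        \<open>(y, x)\<close> to \<open>(- x, - y)\<close>; a second or first entry stays in its
        place.\<close>
      have "F (y, x) = \<pi> (y, x)" using \<pi> that by simp
      then show ?thesis
        using sym[of y x] sym[of "- x" "- y"] q[of "- x" "- y"] BI that False \<pi>(1) by auto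
    qed
    then show ?thesis using \<pi> by blast
  qed
  ultimately show "quasitrivial_semigroup_B n F"
    using asm R unfolding quasitrivial_semigroup_B_def by blast
qed

section \<open>Roots in the orthogonal basis\<close>

text \<open>Allowing the index \<open>0\<close>, with \<open>e\<^sub>0 = 0\<close>, makes long and short roots uniform: the roots are
  the sums \<open>e\<^sub>a + e\<^sub>b\<close> with \<open>\<bar>a\<bar> \<noteq> \<bar>b\<bar>\<close>.\<close>

definition signed_sum :: "(nat \<Rightarrow> 'v::real_vector) \<Rightarrow> int \<Rightarrow> 'v" where
  "signed_sum \<alpha> a = (if 0 \<le> a then \<Sum>j=1..nat a. \<alpha> j else - (\<Sum>j=1..nat (- a). \<alpha> j))"

lemma signed_sum_0 [simp]: "signed_sum \<alpha> 0 = 0"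
  by (simp add: signed_sum_def)

lemma signed_sum_uminus [simp]: "signed_sum \<alpha> (- a) = - signed_sum \<alpha> a"
  by (auto simp: signed_sum_def)

lemma sum_signed_sum:
  assumes "0 \<le> a" "a \<le> b"
  shows "(\<Sum>j=nat a + 1..nat b. \<alpha> j) = signed_sum \<alpha> b - signed_sum \<alpha> a"
proof -
  have "(\<Sum>j=1..nat b. \<alpha> j) = (\<Sum>j=1..nat a. \<alpha> j) + (\<Sum>j=nat a + 1..nat b. \<alpha> j)"
    using assms sum.ub_add_nat[of 1 "nat a" \<alpha> "nat b - nat a"] by (simp add: nat_mono)
  then show ?thesis using assms by (simp add: signed_sum_def)
qed

text \<open>For \<open>r < 0\<close> the doubled part contributes \<open>2 e\<^sub>-\<^sub>r\<close>
  and the rest \<open>e\<^sub>s - e\<^sub>-\<^sub>r\<close>, with total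
  \<open>e\<^sub>s - e\<^sub>r\<close>. At \<open>r = - s\<close> this formula would give
  \<open>2 e\<^sub>s\<close>, which is why the short roots stand apart.\<close>

lemma basic_label_signed_sum:
  assumes "r \<noteq> 0" "\<bar>r\<bar> \<le> s" "r \<noteq> s"
  shows "basic_label \<alpha> r s =
    (if r = - s then signed_sum \<alpha> s else signed_sum \<alpha> s - signed_sum \<alpha> r)"
  using assms sum_signed_sum[of r s \<alpha>] sum_signed_sum[of "- r" s \<alpha>]
  by (auto simp: basic_label_def signed_sum_def scaleR_2 sum.distrib)

lemma root_label_signed_sum:
  assumes "r \<noteq> 0" "s \<noteq> 0" "r \<noteq> s"
  shows "root_label \<alpha> r s =
    (if r = - s then signed_sum \<alpha> s else signed_sum \<alpha> s - signed_sum \<alpha> r)"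
  using assms by (auto simp: root_label_def basic_label_signed_sum)

text \<open>The first family is \<open>e\<^sub>k - e\<^sub>i\<^sub>-\<^sub>1\<close>, where
  \<open>i = 1\<close> produces the index \<open>0\<close> and hence a short root; the second is
  \<open>e\<^sub>k + e\<^sub>p\<close>. Conversely, after a swap and a change of sign one may assume
  \<open>\<bar>a\<bar> < b\<close>, and the sign of \<open>a\<close> decides between the
  families.\<close>

lemma roots_B_signed_sum:
  "roots_B \<alpha> n = {signed_sum \<alpha> a + signed_sum \<alpha> b | a b.
     \<bar>a\<bar> \<le> int n \<and> \<bar>b\<bar> \<le> int n \<and> \<bar>a\<bar> \<noteq> \<bar>b\<bar>}" 
proof -
  define S where "S = {signed_sum \<alpha> a + signed_sum \<alpha> b | a b.
     \<bar>a\<bar> \<le> int n \<and> \<bar>b\<bar> \<le> int n \<and> \<bar>a\<bar> \<noteq> \<bar>b\<bar>}"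
  have S: "signed_sum \<alpha> a + signed_sum \<alpha> b \<in> S"
    if "\<bar>a\<bar> \<le> int n" "\<bar>b\<bar> \<le> int n" "\<bar>a\<bar> \<noteq> \<bar>b\<bar>" for a b
    unfolding S_def using that by blast
  have neg: "- x \<in> S" if x: "x \<in> S" for x
  proof -
    obtain a b where "x = signed_sum \<alpha> a + signed_sum \<alpha> b"
      "\<bar>a\<bar> \<le> int n" "\<bar>b\<bar> \<le> int n" "\<bar>a\<bar> \<noteq> \<bar>b\<bar>" using x unfolding S_def by blast
    then show ?thesis using S[of "- a" "- b"] by simp
  qed
  have "(\<Sum>j=i..k. \<alpha> j) \<in> S" if "1 \<le> i" "i \<le> k" "k \<le> n" for i k
  proof -
    have "(\<Sum>j=i..k. \<alpha> j) = signed_sum \<alpha> (- (int i - 1)) + signed_sum \<alpha> (int k)"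
      using sum_signed_sum[of "int i - 1" "int k" \<alpha>] that
      by (simp add: nat_diff_distrib' del: signed_sum_uminus minus_diff_eq
          add: signed_sum_uminus[of \<alpha> "int i - 1"])
    then show ?thesis using S[of "- (int i - 1)" "int k"] that by auto
  qed
  moreover have "(\<Sum>j=1..k. 2 *\<^sub>R \<alpha> j) + (\<Sum>j=k+1..p. \<alpha> j) \<in> S"
    if "1 \<le> k" "k < p" "p \<le> n" for k p
  proof -
    have "(\<Sum>j=1..k. 2 *\<^sub>R \<alpha> j) + (\<Sum>j=k+1..p. \<alpha> j) = signed_sum \<alpha> (int k) + signed_sum \<alpha> (int p)"
      using sum_signed_sum[of "int k" "int p" \<alpha>] that
      by (simp add: scaleR_2 sum.distrib signed_sum_def)
    then show ?thesis using S[of "int k" "int p"] that by auto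
  qed
  ultimately have sub: "roots_B \<alpha> n \<subseteq> S"
    unfolding roots_B_def using neg by blast
  have neg_root: "- x \<in> roots_B \<alpha> n" if "x \<in> roots_B \<alpha> n" for x
  proof -
    have *: "- x = s \<or> - x = - s \<longleftrightarrow> x = s \<or> x = - s" for s
      by (auto simp: minus_equation_iff)
    from that show ?thesis unfolding roots_B_def Un_iff mem_Collect_eq * .
  qed
  have pos: "signed_sum \<alpha> a + signed_sum \<alpha> b \<in> roots_B \<alpha> n" if "\<bar>a\<bar> < b" "b \<le> int n" for a b
  proof (cases "a \<le> 0")
    case True
    have "signed_sum \<alpha> a + signed_sum \<alpha> b = (\<Sum>j=nat (- a) + 1..nat b. \<alpha> j)"
      using True that sum_signed_sum[of "- a" b \<alpha>] by simp
    moreover have "1 \<le> nat (- a) + 1" "nat (- a) + 1 \<le> nat b" "nat b \<le> n" using that by auto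
    ultimately show ?thesis unfolding roots_B_def by blast
  next
    case False
    have "signed_sum \<alpha> a + signed_sum \<alpha> b =
        (\<Sum>j=1..nat a. 2 *\<^sub>R \<alpha> j) + (\<Sum>j=nat a + 1..nat b. \<alpha> j)"
      using False that sum_signed_sum[of a b \<alpha>] by (simp add: scaleR_2 sum.distrib signed_sum_def)
    moreover have "1 \<le> nat a" "nat a < nat b" "nat b \<le> n" using that False by auto
    ultimately show ?thesis unfolding roots_B_def by blast
  qed
  have lt: "signed_sum \<alpha> a + signed_sum \<alpha> b \<in> roots_B \<alpha> n"
    if "\<bar>a\<bar> < \<bar>b\<bar>" "\<bar>b\<bar> \<le> int n" for a b
    using pos[of a b] neg_root[OF pos[of "- a" "- b"]] that by (cases "0 < b") (auto simp: add.commute)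
  have "signed_sum \<alpha> a + signed_sum \<alpha> b \<in> roots_B \<alpha> n"
    if "\<bar>a\<bar> \<noteq> \<bar>b\<bar>" "\<bar>a\<bar> \<le> int n" "\<bar>b\<bar> \<le> int n" for a b
    using lt[of a b] lt[of b a] that by (cases "\<bar>a\<bar> < \<bar>b\<bar>") (auto simp: add.commute)
  then have "S \<subseteq> roots_B \<alpha> n" unfolding S_def by blast
  with sub show ?thesis unfolding S_def by blast
qed

lemma signed_indices_iff: "x \<in> signed_indices n \<longleftrightarrow> x \<noteq> 0 \<and> \<bar>x\<bar> \<le> int n"
proof
  assume x: "x \<noteq> 0 \<and> \<bar>x\<bar> \<le> int n"
  then have "x \<in> {1..int n} \<or> - x \<in> {1..int n}" by auto
  then show "x \<in> signed_indices n" unfolding signed_indices_def by (metis UnCI image_eqI minus_minus)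
qed (auto simp: signed_indices_def)

lemma roots_B_root_label:
  "roots_B \<alpha> n = {root_label \<alpha> x y | x y. x \<in> signed_indices n \<and> y \<in> signed_indices n \<and> x \<noteq> y}"
  (is "_ = ?S")
proof
  show "roots_B \<alpha> n \<subseteq> ?S"
  proof
    fix v assume "v \<in> roots_B \<alpha> n"
    then obtain a b where ab: "v = signed_sum \<alpha> a + signed_sum \<alpha> b"
      "\<bar>a\<bar> \<le> int n" "\<bar>b\<bar> \<le> int n" "\<bar>a\<bar> \<noteq> \<bar>b\<bar>"
      unfolding roots_B_signed_sum by blast
    \<comment> \<open>A summand with index \<open>0\<close> signals a short root, whose label has
      opposite indices: the missing index is replaced by the negative of the other one.\<close>
    define x where "x = (if a = 0 then - b else - a)"
    define y where "y = (if b = 0 then a else b)"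
    have "x \<in> signed_indices n" "y \<in> signed_indices n" "x \<noteq> y"
      using ab by (auto simp: signed_indices_iff x_def y_def)
    moreover have "v = root_label \<alpha> x y"
      using ab by (auto simp: x_def y_def root_label_signed_sum)
    ultimately show "v \<in> ?S" by blast
  qed
  show "?S \<subseteq> roots_B \<alpha> n"
  proof
    fix v assume "v \<in> ?S"
    then obtain x y where xy: "v = root_label \<alpha> x y" "x \<in> signed_indices n" "y \<in> signed_indices n" "x \<noteq> y"
      by blast
    have "v = signed_sum \<alpha> (if x = - y then 0 else - x) + signed_sum \<alpha> y"
      using xy by (simp add: root_label_signed_sum signed_indices_iff)
    then show "v \<in> roots_B \<alpha> n"
      unfolding roots_B_signed_sum using xy
      by (intro CollectI exI[of _ "if x = - y then 0 else - x"] exI[of _ y]) (auto simp: signed_indices_iff)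
  qed
qed

section \<open>Coordinates: recovering indices from sums\<close>

text \<open>This is the coefficient of \<open>e\<^sub>k\<close> in \<open>e\<^sub>a\<close>,
  extended to negative \<open>k\<close> by a sign and to \<open>0\<close> by zero. Integer values
  allow parity arguments.\<close>

definition coord :: "int \<Rightarrow> int \<Rightarrow> int" where
  "coord k a = of_bool (a = k) - of_bool (a = - k)"

lemma coord_uminus [simp]: "coord k (- a) = - coord k a"
  by (auto simp: coord_def)

lemma coordinate_functional:
  fixes \<alpha> :: "nat \<Rightarrow> 'v::real_vector"
  assumes inj: "inj_on \<alpha> {1..n}" and ind: "independent (\<alpha> ` {1..n})"
  obtains \<phi> :: "'v \<Rightarrow> real" where "linear \<phi>"
    "\<And>a. \<bar>a\<bar> \<le> int n \<Longrightarrow> \<phi> (signed_sum \<alpha> a) = of_int (coord k a)"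
proof -
  \<comment> \<open>Since \<open>\<alpha>\<^sub>j = e\<^sub>j - e\<^sub>j\<^sub>-\<^sub>1\<close>,
    the functional dual to \<open>e\<^sub>k\<close> for \<open>k > 0\<close> is \<open>1\<close> at
    \<open>j = k\<close>, \<open>-1\<close> at \<open>j = k + 1\<close> and \<open>0\<close> at the
    other \<open>j\<close>, so that its partial sums telescope. The factor \<open>sgn k\<close>
    covers negative \<open>k\<close> and gives the zero functional for \<open>k = 0\<close>.\<close>
  define f :: "nat \<Rightarrow> real" where
    "f j = of_int (sgn k) * (of_bool (int j = \<bar>k\<bar>) - of_bool (int j = \<bar>k\<bar> + 1))" for j
  obtain g :: "'v \<Rightarrow> real" where g: "linear g"
    "\<forall>x\<in>\<alpha> ` {1..n}. g x = f (inv_into {1..n} \<alpha> x)"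
    using linear_independent_extend[OF ind, of "\<lambda>x. f (inv_into {1..n} \<alpha> x)"] by blast
  have ga: "g (\<alpha> j) = f j" if "j \<in> {1..n}" for j
    using that g(2) inj by simp
  have tel: "(\<Sum>j=1..m. f j) = of_int (sgn k) * of_bool (int m = \<bar>k\<bar>)" for m
    by (induction m) (auto simp: f_def)
  have G: "g (\<Sum>j=1..m. \<alpha> j) = of_int (sgn k) * of_bool (int m = \<bar>k\<bar>)" if "m \<le> n" for m
  proof -
    have "g (\<Sum>j=1..m. \<alpha> j) = (\<Sum>j=1..m. f j)"
      using that ga by (simp add: linear_sum[OF g(1)])
    then show ?thesis using tel by simp
  qed
  have "g (signed_sum \<alpha> a) = of_int (coord k a)" if "\<bar>a\<bar> \<le> int n" for a
  proof (cases "0 \<le> a")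
    case True
    then show ?thesis
      using that G[of "nat a"] by (auto simp: signed_sum_def coord_def sgn_if split: if_splits)
  next
    case False
    then show ?thesis
      using that G[of "nat (- a)"]
      by (auto simp: signed_sum_def coord_def sgn_if linear_neg[OF g(1)] split: if_splits)
  qed
  with g(1) show ?thesis by (rule that)
qed

text \<open>Linear independence enters the later arguments through this lemma alone, which replaces
  a vector identity by one integer identity for each \<open>k\<close>. Lists serve both two and four
  summands.\<close>

lemma signed_sum_coord:
  fixes \<alpha> :: "nat \<Rightarrow> 'v::real_vector"
  assumes "inj_on \<alpha> {1..n}" "independent (\<alpha> ` {1..n})"
    and "(\<Sum>a\<leftarrow>as. signed_sum \<alpha> a) = (\<Sum>a\<leftarrow>bs. signed_sum \<alpha> a)"
    and "\<forall>a \<in> set as \<union> set bs. \<bar>a\<bar> \<le> int n"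
  shows "(\<Sum>a\<leftarrow>as. coord k a) = (\<Sum>a\<leftarrow>bs. coord k a)"
proof -
  obtain \<phi> :: "'v \<Rightarrow> real" where \<phi>: "linear \<phi>"
    "\<And>a. \<bar>a\<bar> \<le> int n \<Longrightarrow> \<phi> (signed_sum \<alpha> a) = of_int (coord k a)"
    using coordinate_functional[OF assms(1,2)] by blast
  have "\<phi> (\<Sum>a\<leftarrow>cs. signed_sum \<alpha> a) = of_int (\<Sum>a\<leftarrow>cs. coord k a)"
    if "set cs \<subseteq> set as \<union> set bs" for cs
    using that
  proof (induction cs)
    case (Cons c cs)
    then have "\<bar>c\<bar> \<le> int n" using assms(4) by auto
    then show ?case using Cons by (simp add: linear_add[OF \<phi>(1)] \<phi>(2))
  qed (simp add: linear_0[OF \<phi>(1)])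
  from this[of as] this[of bs] assms(3) show ?thesis by simp
qed

text \<open>At \<open>k = a \<noteq> 0\<close> the left side is \<open>1\<close>, so
  \<open>a\<close> must occur on the right; the same holds for the other indices, and each side
  contains \<open>0\<close> at most once.\<close>

lemma coord_pair_eq:
  assumes eq: "\<And>k. coord k a + coord k b = coord k c + coord k d"
    and ne: "\<bar>a\<bar> \<noteq> \<bar>b\<bar>" "\<bar>c\<bar> \<noteq> \<bar>d\<bar>"
  shows "a = c \<and> b = d \<or> a = d \<and> b = c"
proof -
  have 1: "a = 0 \<or> a = c \<or> a = d"
    using eq[of a] ne by (auto simp: coord_def of_bool_def split: if_splits)
  have 2: "b = 0 \<or> b = c \<or> b = d"
    using eq[of b] ne by (auto simp: coord_def of_bool_def split: if_splits)
  have 3: "c = 0 \<or> c = a \<or> c = b"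
    using eq[of c] ne by (auto simp: coord_def of_bool_def split: if_splits)
  have 4: "d = 0 \<or> d = a \<or> d = b"
    using eq[of d] ne by (auto simp: coord_def of_bool_def split: if_splits)
  from 1 2 3 4 ne show ?thesis by auto
qed

text \<open>Parity: for \<open>\<bar>a\<bar> = \<bar>b\<bar>\<close> every coordinate is even,
  whereas \<open>u\<close> and \<open>v\<close> are not both \<open>0\<close> and a nonzero one of
  them gives the coordinate \<open>1\<close>.\<close>

lemma coord_pair_abs_neq:
  assumes eq: "\<And>k. coord k a + coord k b = coord k u + coord k v" and ne: "\<bar>u\<bar> \<noteq> \<bar>v\<bar>"
  shows "\<bar>a\<bar> \<noteq> \<bar>b\<bar>"
proof
  assume "\<bar>a\<bar> = \<bar>b\<bar>"
  then have "even (coord k u + coord k v)" for k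
    unfolding eq[symmetric] by (auto simp: abs_eq_iff)
  moreover have "coord k k + coord k l = 1" if "k \<noteq> 0" "\<bar>k\<bar> \<noteq> \<bar>l\<bar>" for k l
    using that by (auto simp: coord_def)
  ultimately show False using ne by (metis abs_zero add.commute odd_one)
qed

text \<open>A sum of two roots is a root only if a summand of one cancels a summand of the other.
  Two indices \<open>0\<close> count as cancelling, which covers the sum of two short roots.\<close>

lemma coord_add_root:
  assumes eq: "\<And>k. coord k a + coord k b + (coord k c + coord k d) = coord k u + coord k v"
    and ne: "\<bar>a\<bar> \<noteq> \<bar>b\<bar>" "\<bar>c\<bar> \<noteq> \<bar>d\<bar>" "\<bar>u\<bar> \<noteq> \<bar>v\<bar>"
  shows "c = - a \<and> \<bar>b\<bar> \<noteq> \<bar>d\<bar> \<or> d = - a \<and> \<bar>b\<bar> \<noteq> \<bar>c\<bar> \<or>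
         c = - b \<and> \<bar>a\<bar> \<noteq> \<bar>d\<bar> \<or> d = - b \<and> \<bar>a\<bar> \<noteq> \<bar>c\<bar>"
proof -
  consider "c = - a" | "d = - a" | "c = - b" | "d = - b"
    | "c \<noteq> - a" "d \<noteq> - a" "c \<noteq> - b" "d \<noteq> - b" by blast
  then show ?thesis
  proof cases
    case 1
    then show ?thesis using coord_pair_abs_neq[of b d u v] eq ne by simp
  next
    case 2
    then show ?thesis using coord_pair_abs_neq[of b c u v] eq ne by simp
  next
    case 3
    then show ?thesis using coord_pair_abs_neq[of a d u v] eq ne by simp
  next
    case 4
    then show ?thesis using coord_pair_abs_neq[of a c u v] eq ne by simp
  next
    case 5
    have uv: "coord k u + coord k v \<le> 1" "coord k u + coord k v = 1 \<Longrightarrow> k = u \<or> k = v" for k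
      using ne(3) by (auto simp: coord_def of_bool_def split: if_splits)
    have self: "coord k k = 1" if "k \<noteq> 0" for k using that by (simp add: coord_def)
    have ge: "coord k x \<ge> 0" if "x \<noteq> - k" for x k
      using that by (simp add: coord_def)
    have zero: "coord k x = 0" if "\<bar>x\<bar> \<noteq> \<bar>k\<bar>" for x k
      using that by (auto simp: coord_def)
    have main: "(x = u \<or> x = v) \<and> x \<noteq> z \<and> x \<noteq> w"
      if "x \<noteq> 0" "\<bar>y\<bar> \<noteq> \<bar>x\<bar>" "z \<noteq> - x" "w \<noteq> - x"
        "coord x x + coord x y + (coord x z + coord x w) = coord x u + coord x v" for x y z w
      using uv[of x] self[OF that(1)] zero[OF that(2)] ge[OF that(3)] ge[OF that(4)] that(5)
      by (cases "x = z"; cases "x = w") auto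
    have a: "a = 0 \<or> (a = u \<or> a = v) \<and> a \<noteq> c \<and> a \<noteq> d"
      using main[of a b c d] eq[of a] 5 ne by auto
    have b: "b = 0 \<or> (b = u \<or> b = v) \<and> b \<noteq> c \<and> b \<noteq> d"
      using main[of b a c d] eq[of b] 5 ne by auto
    have c: "c = 0 \<or> (c = u \<or> c = v) \<and> c \<noteq> a \<and> c \<noteq> b"
      using main[of c d a b] eq[of c] 5 ne by auto
    have d: "d = 0 \<or> (d = u \<or> d = v) \<and> d \<noteq> a \<and> d \<noteq> b"
      using main[of d c a b] eq[of d] 5 ne by auto
    \<comment> \<open>Without cancellation at most one of the four indices is \<open>0\<close>. The
      others are distinct and would all lie in \<open>{u, v}\<close>, which has room for only
      two.\<close>
    have "\<not> (a = 0 \<and> c = 0)" "\<not> (a = 0 \<and> d = 0)" "\<not> (b = 0 \<and> c = 0)" "\<not> (b = 0 \<and> d = 0)"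
      using 5 by auto
    with a b c d ne show ?thesis by auto
  qed
qed

lemma signed_sum_pair_eq:
  fixes \<alpha> :: "nat \<Rightarrow> 'v::real_vector"
  assumes ind: "inj_on \<alpha> {1..n}" "independent (\<alpha> ` {1..n})"
    and eq: "signed_sum \<alpha> a + signed_sum \<alpha> b = signed_sum \<alpha> c + signed_sum \<alpha> d"
    and le: "\<bar>a\<bar> \<le> int n" "\<bar>b\<bar> \<le> int n" "\<bar>c\<bar> \<le> int n" "\<bar>d\<bar> \<le> int n"
    and ne: "\<bar>a\<bar> \<noteq> \<bar>b\<bar>" "\<bar>c\<bar> \<noteq> \<bar>d\<bar>"
  shows "a = c \<and> b = d \<or> a = d \<and> b = c"
proof (rule coord_pair_eq[OF _ ne])
  show "coord k a + coord k b = coord k c + coord k d" for k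
    using signed_sum_coord[OF ind, of "[a, b]" "[c, d]" k] eq le by simp
qed

lemma signed_sum_add_root:
  fixes \<alpha> :: "nat \<Rightarrow> 'v::real_vector"
  assumes ind: "inj_on \<alpha> {1..n}" "independent (\<alpha> ` {1..n})"
    and eq: "signed_sum \<alpha> a + signed_sum \<alpha> b + (signed_sum \<alpha> c + signed_sum \<alpha> d) =
      signed_sum \<alpha> u + signed_sum \<alpha> v"
    and le: "\<bar>a\<bar> \<le> int n" "\<bar>b\<bar> \<le> int n" "\<bar>c\<bar> \<le> int n" "\<bar>d\<bar> \<le> int n" "\<bar>u\<bar> \<le> int n" "\<bar>v\<bar> \<le> int n"
    and ne: "\<bar>a\<bar> \<noteq> \<bar>b\<bar>" "\<bar>c\<bar> \<noteq> \<bar>d\<bar>" "\<bar>u\<bar> \<noteq> \<bar>v\<bar>"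
  shows "c = - a \<and> \<bar>b\<bar> \<noteq> \<bar>d\<bar> \<or> d = - a \<and> \<bar>b\<bar> \<noteq> \<bar>c\<bar> \<or>
         c = - b \<and> \<bar>a\<bar> \<noteq> \<bar>d\<bar> \<or> d = - b \<and> \<bar>a\<bar> \<noteq> \<bar>c\<bar>"
proof (rule coord_add_root[OF _ ne])
  show "coord k a + coord k b + (coord k c + coord k d) = coord k u + coord k v" for k
    using signed_sum_coord[OF ind, of "[a, b, c, d]" "[u, v]" k] eq le by (simp add: add.assoc)
qed

section \<open>Biclosed sets as relations\<close>

text \<open>With \<open>Q a b\<close> read as membership of \<open>e\<^sub>a + e\<^sub>b\<close>,
  this is closedness under \<open>(e\<^sub>a + e\<^sub>b) + (- e\<^sub>b + e\<^sub>c) = e\<^sub>a +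
  e\<^sub>c\<close>. The three inequalities make all three sums roots; the indices may be
  \<open>0\<close>.\<close>

definition sum_closed :: "nat \<Rightarrow> (int \<Rightarrow> int \<Rightarrow> bool) \<Rightarrow> bool" where
  "sum_closed n Q \<longleftrightarrow>
     (\<forall>a b c. \<bar>a\<bar> \<le> int n \<longrightarrow> \<bar>b\<bar> \<le> int n \<longrightarrow> \<bar>c\<bar> \<le> int n \<longrightarrow>
        \<bar>a\<bar> \<noteq> \<bar>b\<bar> \<longrightarrow> \<bar>b\<bar> \<noteq> \<bar>c\<bar> \<longrightarrow> \<bar>a\<bar> \<noteq> \<bar>c\<bar> \<longrightarrow> Q a b \<longrightarrow> Q (- b) c \<longrightarrow> Q a c)"

lemma sum_closedD:
  assumes "sum_closed n Q" "Q a b" "Q (- b) c"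
    "\<bar>a\<bar> \<le> int n" "\<bar>b\<bar> \<le> int n" "\<bar>c\<bar> \<le> int n" "\<bar>a\<bar> \<noteq> \<bar>b\<bar>" "\<bar>b\<bar> \<noteq> \<bar>c\<bar>" "\<bar>a\<bar> \<noteq> \<bar>c\<bar>"
  shows "Q a c"
  using assms unfolding sum_closed_def by blast

lemma sum_closed_cong:
  assumes "\<And>a b. \<bar>a\<bar> \<le> int n \<Longrightarrow> \<bar>b\<bar> \<le> int n \<Longrightarrow> \<bar>a\<bar> \<noteq> \<bar>b\<bar> \<Longrightarrow> Q a b \<longleftrightarrow> Q' a b"
  shows "sum_closed n Q \<longleftrightarrow> sum_closed n Q'"
proof -
  have "Q (- b) c \<longleftrightarrow> Q' (- b) c" if "\<bar>b\<bar> \<le> int n" "\<bar>c\<bar> \<le> int n" "\<bar>b\<bar> \<noteq> \<bar>c\<bar>" for b c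
    using assms[of "- b" c] that by simp
  with assms show ?thesis unfolding sum_closed_def by (simp cong: imp_cong)
qed

text \<open>The label \<open>\<alpha>\<^sub>x\<^sub>,\<^sub>y\<close> is the sum with indices
  \<open>- x\<close> and \<open>y\<close>, where \<open>0\<close> replaces \<open>- x\<close> if the
  root is short; so this is \<open>Q\<close> transported to labels.\<close>

definition label_rel :: "(int \<Rightarrow> int \<Rightarrow> bool) \<Rightarrow> int \<Rightarrow> int \<Rightarrow> bool" where
  "label_rel Q x y = Q (if x = - y then 0 else - x) y"

lemma root_label_sum:
  assumes "x \<in> signed_indices n" "y \<in> signed_indices n" "x \<noteq> y"
  shows "root_label \<alpha> x y = signed_sum \<alpha> (if x = - y then 0 else - x) + signed_sum \<alpha> y"
  using assms by (simp add: root_label_signed_sum signed_indices_iff)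

text \<open>By \<open>signed_sum_add_root\<close> a root that is a sum of two roots arises by
  cancelling one summand; the four cases differ only in the order of the summands.\<close>

lemma closed_roots_iff_sum_closed:
  fixes \<alpha> :: "nat \<Rightarrow> 'v::real_vector"
  assumes ind: "inj_on \<alpha> {1..n}" "independent (\<alpha> ` {1..n})"
    and C: "C \<subseteq> roots_B \<alpha> n"
  shows "closed_roots (roots_B \<alpha> n) C \<longleftrightarrow>
    sum_closed n (\<lambda>a b. signed_sum \<alpha> a + signed_sum \<alpha> b \<in> C)"
proof
  assume cl: "closed_roots (roots_B \<alpha> n) C"
  show "sum_closed n (\<lambda>a b. signed_sum \<alpha> a + signed_sum \<alpha> b \<in> C)"
    unfolding sum_closed_def
  proof (intro allI impI)
    fix a b c
    assume le: "\<bar>a\<bar> \<le> int n" "\<bar>b\<bar> \<le> int n" "\<bar>c\<bar> \<le> int n" and ne: "\<bar>a\<bar> \<noteq> \<bar>c\<bar>"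
      and mem: "signed_sum \<alpha> a + signed_sum \<alpha> b \<in> C" "signed_sum \<alpha> (- b) + signed_sum \<alpha> c \<in> C"
    have "signed_sum \<alpha> a + signed_sum \<alpha> c \<in> roots_B \<alpha> n"
      unfolding roots_B_signed_sum using le ne by blast
    moreover have "signed_sum \<alpha> a + signed_sum \<alpha> b + (signed_sum \<alpha> (- b) + signed_sum \<alpha> c) =
        signed_sum \<alpha> a + signed_sum \<alpha> c" by simp
    ultimately show "signed_sum \<alpha> a + signed_sum \<alpha> c \<in> C"
      using cl mem unfolding closed_roots_def by metis
  qed
next
  assume sc: "sum_closed n (\<lambda>a b. signed_sum \<alpha> a + signed_sum \<alpha> b \<in> C)"
  have step: "x + y \<in> C"
    if "x \<in> C" "y \<in> C" "x = signed_sum \<alpha> a + signed_sum \<alpha> b" "y = signed_sum \<alpha> (- b) + signed_sum \<alpha> c"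
      "\<bar>a\<bar> \<le> int n" "\<bar>b\<bar> \<le> int n" "\<bar>c\<bar> \<le> int n" "\<bar>a\<bar> \<noteq> \<bar>b\<bar>" "\<bar>b\<bar> \<noteq> \<bar>c\<bar>" "\<bar>a\<bar> \<noteq> \<bar>c\<bar>"
    for x y a b c
  proof -
    have "signed_sum \<alpha> a + signed_sum \<alpha> c \<in> C"
      by (rule sum_closedD[OF sc, of a b c]) (use that in simp_all)
    then show ?thesis using that(3,4) by simp
  qed
  show "closed_roots (roots_B \<alpha> n) C"
    unfolding closed_roots_def
  proof (intro conjI C ballI impI)
    fix x y assume x: "x \<in> C" and y: "y \<in> C" and xy: "x + y \<in> roots_B \<alpha> n"
    obtain a b where ab: "x = signed_sum \<alpha> a + signed_sum \<alpha> b" "\<bar>a\<bar> \<le> int n" "\<bar>b\<bar> \<le> int n" "\<bar>a\<bar> \<noteq> \<bar>b\<bar>"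
      using x C unfolding roots_B_signed_sum by blast
    obtain c d where cd: "y = signed_sum \<alpha> c + signed_sum \<alpha> d" "\<bar>c\<bar> \<le> int n" "\<bar>d\<bar> \<le> int n" "\<bar>c\<bar> \<noteq> \<bar>d\<bar>"
      using y C unfolding roots_B_signed_sum by blast
    obtain u v where uv: "x + y = signed_sum \<alpha> u + signed_sum \<alpha> v" "\<bar>u\<bar> \<le> int n" "\<bar>v\<bar> \<le> int n" "\<bar>u\<bar> \<noteq> \<bar>v\<bar>"
      using xy unfolding roots_B_signed_sum by blast
    have x': "x = signed_sum \<alpha> b + signed_sum \<alpha> a" and y': "y = signed_sum \<alpha> d + signed_sum \<alpha> c"
      using ab cd by (simp_all add: add.commute)
    consider "c = - a" "\<bar>b\<bar> \<noteq> \<bar>d\<bar>" | "d = - a" "\<bar>b\<bar> \<noteq> \<bar>c\<bar>"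
      | "c = - b" "\<bar>a\<bar> \<noteq> \<bar>d\<bar>" | "d = - b" "\<bar>a\<bar> \<noteq> \<bar>c\<bar>"
      using signed_sum_add_root[OF ind uv(1)[unfolded ab(1) cd(1)]] ab cd uv by blast
    then show "x + y \<in> C"
    proof cases
      case 1
      show ?thesis by (rule step[OF x y x', where c = d]) (use cd cd(2-) ab(2-) 1 in auto)
    next
      case 2
      show ?thesis by (rule step[OF x y x', where c = c]) (use y' cd(2-) ab(2-) 2 in auto)
    next
      case 3
      show ?thesis by (rule step[OF x y ab(1), where c = d]) (use cd cd(2-) ab(2-) 3 in auto)
    next
      case 4
      show ?thesis by (rule step[OF x y ab(1), where c = c]) (use y' cd(2-) ab(2-) 4 in auto)
    qed
  qed
qed

section \<open>Closedness against transitivity\<close>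

text \<open>For distinct \<open>r\<close>, \<open>s\<close>, \<open>t\<close> at most one of the
  three labels is short. If none is, one addition suffices. A short label among the premises
  requires its root to be added twice; a short label in the conclusion requires closedness of the
  complement.\<close>

lemma trans_on_distinct_label_rel:
  assumes sym: "\<And>a b. Q a b \<Longrightarrow> Q b a"
    and sc: "sum_closed n Q" "sum_closed n (\<lambda>a b. \<not> Q a b)"
  shows "trans_on_distinct (signed_indices n) (label_rel Q)"
  unfolding trans_on_distinct_def
proof (intro ballI impI)
  fix r s t
  assume I: "r \<in> signed_indices n" "s \<in> signed_indices n" "t \<in> signed_indices n"
    and ne: "r \<noteq> s" "s \<noteq> t" "r \<noteq> t" and P: "label_rel Q r s" "label_rel Q s t"
  have le: "r \<noteq> 0" "s \<noteq> 0" "t \<noteq> 0" "\<bar>r\<bar> \<le> int n" "\<bar>s\<bar> \<le> int n" "\<bar>t\<bar> \<le> int n"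
    using I by (auto simp: signed_indices_iff)
  consider "r = - s" | "s = - t" "r \<noteq> - s" | "r = - t" "r \<noteq> - s" "s \<noteq> - t"
    | "r \<noteq> - s" "s \<noteq> - t" "r \<noteq> - t" by blast
  then show "label_rel Q r t"
  proof cases
    case 1
    \<comment> \<open>Here \<open>\<alpha>\<^sub>r\<^sub>,\<^sub>t = e\<^sub>s + e\<^sub>t\<close>:
      adding \<open>e\<^sub>s\<close> to \<open>- e\<^sub>s + e\<^sub>t\<close> yields
      \<open>e\<^sub>t\<close>, and adding it once more yields the goal.\<close>
    then have Q: "Q 0 s" "Q (- s) t" using P ne by (auto simp: label_rel_def)
    then have "Q 0 t" using sum_closedD[OF sc(1), of 0 s t] 1 ne le by auto
    then show ?thesis
      using sum_closedD[OF sc(1) sym[OF Q(1)], of t] 1 ne le by (auto simp: label_rel_def)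
  next
    case 2
    then have Q: "Q (- r) s" "Q 0 (- s)" using P by (auto simp: label_rel_def)
    then have "Q (- r) 0" using sum_closedD[OF sc(1), of "- r" s 0] sym 2 ne le by auto
    then show ?thesis
      using sum_closedD[OF sc(1), of "- r" 0 "- s"] Q 2 ne le by (auto simp: label_rel_def)
  next
    case 3
    then have Q: "Q (- r) s" "Q (- s) (- r)" using P by (auto simp: label_rel_def)
    \<comment> \<open>\<open>(- e\<^sub>r + e\<^sub>s) + (- e\<^sub>s - e\<^sub>r)\<close> is not a root, so closedness of the complement is needed.\<close>
    have "Q 0 (- r)"
    proof (rule ccontr)
      assume 0: "\<not> Q 0 (- r)"
      then have "\<not> Q (- r) 0" using sym by blast
      then have "Q 0 s" using sum_closedD[OF sc(2), of "- r" 0 s] Q 3 ne le by (auto simp: abs_eq_iff)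
      then show False using sum_closedD[OF sc(1), of 0 s "- r"] Q 0 3 ne le by (auto simp: abs_eq_iff)
    qed
    then show ?thesis using 3 by (simp add: label_rel_def)
  next
    case 4
    then show ?thesis
      using sum_closedD[OF sc(1), of "- r" s t] P ne le by (auto simp: label_rel_def abs_eq_iff)
  qed
qed

text \<open>The cases are governed by which index is \<open>0\<close>, that is, by which roots are
  short. A short root in exactly one premise takes two transitivity steps joined by the reflection
  \<open>PS\<close>; two short premises need the complement.\<close>

lemma sum_closed_label_rel:
  assumes sym: "\<And>a b. Q a b \<Longrightarrow> Q b a"
    and bt: "bitrans_on_distinct (signed_indices n) (label_rel Q)"
  shows "sum_closed n Q"
  unfolding sum_closed_def
proof (intro allI impI)
  fix a b c
  assume le: "\<bar>a\<bar> \<le> int n" "\<bar>b\<bar> \<le> int n" "\<bar>c\<bar> \<le> int n"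
    and ne: "\<bar>a\<bar> \<noteq> \<bar>b\<bar>" "\<bar>b\<bar> \<noteq> \<bar>c\<bar>" "\<bar>a\<bar> \<noteq> \<bar>c\<bar>" and Q: "Q a b" "Q (- b) c"
  have neq: "a \<noteq> c" "- a \<noteq> c" "c \<noteq> a" "- c \<noteq> a" "a \<noteq> b" "- a \<noteq> b" "b \<noteq> a" "- b \<noteq> a"
    "b \<noteq> c" "- b \<noteq> c" "c \<noteq> b" "- c \<noteq> b"
    using ne by auto
  let ?P = "label_rel Q"
  have tr: "?P x z" if "?P x y" "?P y z" "x \<noteq> 0" "y \<noteq> 0" "z \<noteq> 0"
      "\<bar>x\<bar> \<le> int n" "\<bar>y\<bar> \<le> int n" "\<bar>z\<bar> \<le> int n" "x \<noteq> y" "y \<noteq> z" "x \<noteq> z" for x y z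
    using trans_on_distinctD[of "signed_indices n" ?P x y z] bt that
    by (simp add: bitrans_on_distinct_def signed_indices_iff)
  have ntr: "\<not> ?P x z" if "\<not> ?P x y" "\<not> ?P y z" "x \<noteq> 0" "y \<noteq> 0" "z \<noteq> 0"
      "\<bar>x\<bar> \<le> int n" "\<bar>y\<bar> \<le> int n" "\<bar>z\<bar> \<le> int n" "x \<noteq> y" "y \<noteq> z" "x \<noteq> z" for x y z
    using trans_on_distinctD[of "signed_indices n" "\<lambda>x y. \<not> ?P x y" x y z] bt that
    by (simp add: bitrans_on_distinct_def signed_indices_iff)
  have PQ: "?P (- x) y \<longleftrightarrow> Q x y" if "x \<noteq> y" for x y using that by (simp add: label_rel_def)
  have P0: "?P (- x) x \<longleftrightarrow> Q 0 x" "?P x (- x) \<longleftrightarrow> Q 0 (- x)" for x by (simp_all add: label_rel_def)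
  have PS: "?P (- y) (- x) \<longleftrightarrow> ?P x y" for x y using sym by (auto simp: label_rel_def)
  consider "a = 0" | "b = 0" | "c = 0" | "a \<noteq> 0" "b \<noteq> 0" "c \<noteq> 0" by blast
  then show "Q a c"
  proof cases
    case 1
    have bc: "?P (- b) b" "?P b c" using Q 1 PQ[of "- b" c] P0[of b] neq by auto
    have "?P (- b) c" by (rule tr[OF bc]) (use neq le 1 in auto)
    moreover have "?P (- c) (- b)" using bc(2) PS by simp
    ultimately have "?P (- c) c" using tr[of "- c" "- b" c] neq le 1 by auto
    then show ?thesis using 1 P0 by simp
  next
    case 2
    have ac: "?P (- a) a" "?P (- c) c" using Q 2 sym P0[of a] P0[of c] by auto
    \<comment> \<open>If \<open>- a, c\<close> is unrelated, so is its reflection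
      \<open>- c, a\<close>. Then \<open>c, a\<close> is unrelated too, since \<open>- c, c\<close>
      is related, and transitivity of the complement along \<open>- a, c, a\<close> contradicts the
      short root \<open>e\<^sub>a\<close>.\<close>
    have "?P (- a) c"
    proof (rule ccontr)
      assume n: "\<not> ?P (- a) c"
      then have n': "\<not> ?P (- c) a" using PS[of c "- a"] by simp
      have "\<not> ?P c a" using tr[OF ac(2), of a] n' neq le 2 by auto
      then show False using ntr[OF n, of a] ac(1) neq le 2 by auto
    qed
    then show ?thesis using PQ[of a c] neq by auto
  next
    case 3
    have ab: "?P (- a) b" "?P b (- b)" using Q 3 sym PQ[of a b] P0(2)[of b] neq by auto
    have "?P (- a) (- b)" by (rule tr[OF ab]) (use neq le 3 in auto)
    then have "?P b a" using PS by simp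
    then have "?P (- a) a" using tr[OF ab(1), of a] neq le 3 by auto
    then show ?thesis using 3 P0 sym by simp
  next
    case 4
    have "?P (- a) b" "?P b c" using Q PQ[of a b] PQ[of "- b" c] neq by auto
    then have "?P (- a) c" using tr[of "- a" b c] 4 neq le by auto
    then show ?thesis using PQ[of a c] neq by auto
  qed
qed

lemma biclosed_roots_B_iff:
  fixes \<alpha> :: "nat \<Rightarrow> 'v::real_vector"
  assumes ind: "inj_on \<alpha> {1..n}" "independent (\<alpha> ` {1..n})"
  shows "biclosed_roots (roots_B \<alpha> n) C \<longleftrightarrow>
    C \<subseteq> roots_B \<alpha> n \<and> bitrans_on_distinct (signed_indices n) (\<lambda>x y. root_label \<alpha> x y \<in> C)"
proof (cases "C \<subseteq> roots_B \<alpha> n")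
  case True
  define Q where "Q a b \<longleftrightarrow> signed_sum \<alpha> a + signed_sum \<alpha> b \<in> C" for a b
  have sym: "Q b a" if "Q a b" for a b using that by (simp add: Q_def add.commute)
  \<comment> \<open>Only pairs that give roots are tested, so the complement within the root system
    may be replaced by plain negation.\<close>
  have "sum_closed n (\<lambda>a b. signed_sum \<alpha> a + signed_sum \<alpha> b \<in> roots_B \<alpha> n - C) \<longleftrightarrow>
      sum_closed n (\<lambda>a b. \<not> Q a b)"
  proof (rule sum_closed_cong)
    fix a b :: int assume "\<bar>a\<bar> \<le> int n" "\<bar>b\<bar> \<le> int n" "\<bar>a\<bar> \<noteq> \<bar>b\<bar>"
    then have "signed_sum \<alpha> a + signed_sum \<alpha> b \<in> roots_B \<alpha> n"
      unfolding roots_B_signed_sum by blast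
    then show "signed_sum \<alpha> a + signed_sum \<alpha> b \<in> roots_B \<alpha> n - C \<longleftrightarrow> \<not> Q a b"
      by (simp add: Q_def)
  qed
  then have "biclosed_roots (roots_B \<alpha> n) C \<longleftrightarrow> sum_closed n Q \<and> sum_closed n (\<lambda>a b. \<not> Q a b)"
    using closed_roots_iff_sum_closed[OF ind True]
      closed_roots_iff_sum_closed[OF ind, of "roots_B \<alpha> n - C"]
    by (simp add: biclosed_roots_def Q_def[abs_def])
  also have "\<dots> \<longleftrightarrow> bitrans_on_distinct (signed_indices n) (label_rel Q)"
  proof
    \<comment> \<open>Transport to labels commutes with negation, so each of the two implications
      can be applied to \<open>Q\<close> and to its negation.\<close>
    have neg: "(\<lambda>x y. \<not> label_rel Q x y) = label_rel (\<lambda>a b. \<not> Q a b)"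
      by (simp add: label_rel_def fun_eq_iff)
    { assume sc: "sum_closed n Q \<and> sum_closed n (\<lambda>a b. \<not> Q a b)"
      have "trans_on_distinct (signed_indices n) (label_rel Q)"
        by (rule trans_on_distinct_label_rel) (use sc sym in auto)
      moreover have "trans_on_distinct (signed_indices n) (label_rel (\<lambda>a b. \<not> Q a b))"
        by (rule trans_on_distinct_label_rel) (use sc sym in auto)
      ultimately show "bitrans_on_distinct (signed_indices n) (label_rel Q)"
        by (simp add: bitrans_on_distinct_def neg) }
    assume bt: "bitrans_on_distinct (signed_indices n) (label_rel Q)"
    then have "bitrans_on_distinct (signed_indices n) (label_rel (\<lambda>a b. \<not> Q a b))"
      by (auto simp: bitrans_on_distinct_def neg[symmetric])
    then have "sum_closed n (\<lambda>a b. \<not> Q a b)"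
      by (rule sum_closed_label_rel[rotated]) (use sym in blast)
    moreover have "sum_closed n Q" by (rule sum_closed_label_rel) (use sym bt in auto)
    ultimately show "sum_closed n Q \<and> sum_closed n (\<lambda>a b. \<not> Q a b)" by blast
  qed
  also have "\<dots> \<longleftrightarrow> bitrans_on_distinct (signed_indices n) (\<lambda>x y. root_label \<alpha> x y \<in> C)"
    by (rule bitrans_on_distinct_cong) (simp add: label_rel_def Q_def root_label_sum)
  finally show ?thesis using True by simp
qed (simp add: biclosed_roots_def closed_roots_def)

section \<open>Coincidences among labels\<close>

lemma root_label_reflect:
  assumes "x \<in> signed_indices n" "y \<in> signed_indices n" "x \<noteq> y"
  shows "root_label \<alpha> (- y) (- x) = root_label \<alpha> x y"
  using assms root_label_uminus[of y x \<alpha>] root_label_swap[of x y \<alpha>]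
  by (simp add: signed_indices_iff)

text \<open>A root determines its unordered pair of indices. Exchanging the two entries
  \<open>- x\<close> and \<open>y\<close> is the reflection of the label; with an entry
  \<open>0\<close> no exchange is possible, since \<open>y\<close> and \<open>y'\<close> are
  nonzero.\<close>

lemma root_label_eqD:
  fixes \<alpha> :: "nat \<Rightarrow> 'v::real_vector"
  assumes ind: "inj_on \<alpha> {1..n}" "independent (\<alpha> ` {1..n})"
    and I: "x \<in> signed_indices n" "y \<in> signed_indices n" "x' \<in> signed_indices n" "y' \<in> signed_indices n"
    and ne: "x \<noteq> y" "x' \<noteq> y'"
    and eq: "root_label \<alpha> x y = root_label \<alpha> x' y'"
  shows "x' = x \<and> y' = y \<or> x' = - y \<and> y' = - x"
proof -
  let ?a = "if x = - y then 0 else - x" and ?c = "if x' = - y' then 0 else - x'"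
  have "?a = ?c \<and> y = y' \<or> ?a = y' \<and> y = ?c"
  proof (rule signed_sum_pair_eq[OF ind])
    show "signed_sum \<alpha> ?a + signed_sum \<alpha> y = signed_sum \<alpha> ?c + signed_sum \<alpha> y'"
      using eq root_label_sum I ne by metis
  qed (use I ne in \<open>auto simp: signed_indices_iff\<close>)
  then show ?thesis using I ne by (auto simp: signed_indices_iff split: if_splits)
qed

section \<open>The bijection\<close>

text \<open>One rule serves both orders of a pair, since the opposite root is the label of the
  reversed pair. The restriction makes the operation extensional, as
  \<open>quasitrivial_semigroup\<close> demands.\<close>

definition biclosed_semigroup ::
  "(nat \<Rightarrow> 'v::real_vector) \<Rightarrow> nat \<Rightarrow> 'v set \<Rightarrow> int \<times> int \<Rightarrow> int" where
  "biclosed_semigroup \<alpha> n C = (\<lambda>(x, y) \<in> signed_indices n \<times> signed_indices n.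
     if x \<noteq> y \<and> root_label \<alpha> x y \<in> C then y else x)"

lemma biclosed_semigroup_apply:
  assumes "x \<in> signed_indices n" "y \<in> signed_indices n"
  shows "biclosed_semigroup \<alpha> n C (x, y) = (if x \<noteq> y \<and> root_label \<alpha> x y \<in> C then y else x)"
  using assms by (simp add: biclosed_semigroup_def)

lemma quasitrivial_biclosed_semigroup:
  fixes \<alpha> :: "nat \<Rightarrow> 'v::real_vector"
  assumes ind: "inj_on \<alpha> {1..n}" "independent (\<alpha> ` {1..n})"
    and C: "biclosed_roots (roots_B \<alpha> n) C"
  shows "quasitrivial_semigroup_B n (biclosed_semigroup \<alpha> n C)"
proof -
  let ?I = "signed_indices n" and ?F = "biclosed_semigroup \<alpha> n C"
  have "?F \<in> ?I \<times> ?I \<rightarrow>\<^sub>E ?I" by (auto simp: biclosed_semigroup_def)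
  moreover have "bitrans_on_distinct ?I (\<lambda>x y. ?F (x, y) = y) \<longleftrightarrow>
      bitrans_on_distinct ?I (\<lambda>x y. root_label \<alpha> x y \<in> C)"
    by (rule bitrans_on_distinct_cong) (simp add: biclosed_semigroup_apply)
  moreover have "bitrans_on_distinct ?I (\<lambda>x y. root_label \<alpha> x y \<in> C)"
    using C biclosed_roots_B_iff[OF ind] by blast
  moreover have "\<forall>x\<in>?I. \<forall>y\<in>?I. x \<noteq> y \<longrightarrow> ?F (x, y) = y \<longrightarrow> ?F (- y, - x) = - x"
    by (auto simp: biclosed_semigroup_apply root_label_reflect split: if_splits)
  moreover have "\<forall>a\<in>?I. \<forall>b\<in>?I. ?F (a, b) \<in> {a, b}" by (simp add: biclosed_semigroup_apply)
  ultimately show ?thesis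
    unfolding quasitrivial_semigroup_B_iff quasitrivial_semigroup_iff by blast
qed

text \<open>Every root is a label, so the operation determines \<open>C\<close>. For surjectivity,
  \<open>C\<close> collects the labels of the pairs on which \<open>F\<close> takes its second
  entry.\<close>

lemma bij_betw_biclosed_semigroup:
  fixes \<alpha> :: "nat \<Rightarrow> 'v::real_vector"
  assumes ind: "inj_on \<alpha> {1..n}" "independent (\<alpha> ` {1..n})"
  shows "bij_betw (biclosed_semigroup \<alpha> n)
    {C. biclosed_roots (roots_B \<alpha> n) C} {F. quasitrivial_semigroup_B n F}"
  unfolding bij_betw_def
proof (intro conjI equalityI subsetI)
  let ?I = "signed_indices n"
  show "inj_on (biclosed_semigroup \<alpha> n) {C. biclosed_roots (roots_B \<alpha> n) C}"
  proof (rule inj_onI)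
    fix C D assume CD: "C \<in> {C. biclosed_roots (roots_B \<alpha> n) C}" "D \<in> {C. biclosed_roots (roots_B \<alpha> n) C}"
      and eq: "biclosed_semigroup \<alpha> n C = biclosed_semigroup \<alpha> n D"
    have "root_label \<alpha> x y \<in> C \<longleftrightarrow> root_label \<alpha> x y \<in> D" if "x \<in> ?I" "y \<in> ?I" "x \<noteq> y" for x y
      using fun_cong[OF eq, of "(x, y)"] that by (simp add: biclosed_semigroup_apply split: if_splits)
    moreover have "C \<subseteq> roots_B \<alpha> n" "D \<subseteq> roots_B \<alpha> n"
      using CD by (auto simp: biclosed_roots_def closed_roots_def)
    ultimately show "C = D" unfolding roots_B_root_label by blast
  qed
  show "F \<in> {F. quasitrivial_semigroup_B n F}"
    if "F \<in> biclosed_semigroup \<alpha> n ` {C. biclosed_roots (roots_B \<alpha> n) C}" for F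
    using that quasitrivial_biclosed_semigroup[OF ind] by blast
  fix F assume "F \<in> {F. quasitrivial_semigroup_B n F}"
  then have ext: "F \<in> ?I \<times> ?I \<rightarrow>\<^sub>E ?I" and q: "\<And>a b. a \<in> ?I \<Longrightarrow> b \<in> ?I \<Longrightarrow> F (a, b) = a \<or> F (a, b) = b"
    and bt: "bitrans_on_distinct ?I (\<lambda>x y. F (x, y) = y)"
    and sym: "\<And>x y. x \<in> ?I \<Longrightarrow> y \<in> ?I \<Longrightarrow> x \<noteq> y \<Longrightarrow> F (x, y) = y \<Longrightarrow> F (- y, - x) = - x"
    unfolding mem_Collect_eq quasitrivial_semigroup_B_iff quasitrivial_semigroup_iff by blast+
  define C where "C = {root_label \<alpha> x y | x y. x \<in> ?I \<and> y \<in> ?I \<and> x \<noteq> y \<and> F (x, y) = y}"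
  \<comment> \<open>This is where type B is used: a root has at most one further label, the
    reflected one, and \<open>sym\<close> makes \<open>F\<close> agree on both.\<close>
  have mem: "root_label \<alpha> x y \<in> C \<longleftrightarrow> F (x, y) = y" if xy: "x \<in> ?I" "y \<in> ?I" "x \<noteq> y" for x y
  proof
    assume "root_label \<alpha> x y \<in> C"
    then obtain x' y' where *: "root_label \<alpha> x' y' = root_label \<alpha> x y"
      "x' \<in> ?I" "y' \<in> ?I" "x' \<noteq> y'" "F (x', y') = y'" unfolding C_def by auto
    then have "x = x' \<and> y = y' \<or> x = - y' \<and> y = - x'"
      using root_label_eqD[OF ind] xy by blast
    then show "F (x, y) = y" using * sym by blast
  qed (use xy C_def in blast)
  have "bitrans_on_distinct ?I (\<lambda>x y. root_label \<alpha> x y \<in> C) \<longleftrightarrow>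
      bitrans_on_distinct ?I (\<lambda>x y. F (x, y) = y)"
    by (rule bitrans_on_distinct_cong) (rule mem)
  with bt have "bitrans_on_distinct ?I (\<lambda>x y. root_label \<alpha> x y \<in> C)" by simp
  moreover have "C \<subseteq> roots_B \<alpha> n" unfolding roots_B_root_label C_def by blast
  ultimately have "biclosed_roots (roots_B \<alpha> n) C" using biclosed_roots_B_iff[OF ind] by blast
  moreover have "F = biclosed_semigroup \<alpha> n C"
  proof
    fix p show "F p = biclosed_semigroup \<alpha> n C p"
    proof (cases "p \<in> ?I \<times> ?I")
      case True
      then obtain x y where p: "p = (x, y)" "x \<in> ?I" "y \<in> ?I" by blast
      then show ?thesis using mem[of x y] q[of x y] by (auto simp: biclosed_semigroup_apply)
    next
      case False
      then show ?thesis using PiE_arb[OF ext False] by (simp add: biclosed_semigroup_def)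
    qed
  qed
  ultimately show "F \<in> biclosed_semigroup \<alpha> n ` {C. biclosed_roots (roots_B \<alpha> n) C}" by blast
qed

theorem theorem6p1:
  fixes n :: nat and V :: "'v::real_vector set" and \<alpha> :: "nat \<Rightarrow> 'v"
  assumes "n \<ge> 1"
    and "inj_on \<alpha> {1..n}" and "independent (\<alpha> ` {1..n})" and "span (\<alpha> ` {1..n}) = V"
  shows "\<exists>\<F>. bij_betw \<F> {C. biclosed_roots (roots_B \<alpha> n) C} {F. quasitrivial_semigroup_B n F} \<and>
    (\<forall>C. biclosed_roots (roots_B \<alpha> n) C \<longrightarrow>
      (\<forall>t\<in>signed_indices n. \<forall>m\<in>signed_indices n. t < m \<longrightarrow>
        ({root_label \<alpha> t m, - root_label \<alpha> t m} \<inter> C = {} \<longleftrightarrow>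
           \<F> C (t, m) = t \<and> \<F> C (m, t) = m) \<and>
        (root_label \<alpha> t m \<in> C \<and> - root_label \<alpha> t m \<notin> C \<longleftrightarrow>
           \<F> C (t, m) = m \<and> \<F> C (m, t) = m) \<and>
        (- root_label \<alpha> t m \<in> C \<and> root_label \<alpha> t m \<notin> C \<longleftrightarrow>
           \<F> C (t, m) = t \<and> \<F> C (m, t) = t) \<and>
        ({root_label \<alpha> t m, - root_label \<alpha> t m} \<subseteq> C \<longleftrightarrow>
           \<F> C (t, m) = m \<and> \<F> C (m, t) = t)))"
proof (intro exI[of _ "biclosed_semigroup \<alpha> n"] conjI allI impI ballI)
  show "bij_betw (biclosed_semigroup \<alpha> n)
    {C. biclosed_roots (roots_B \<alpha> n) C} {F. quasitrivial_semigroup_B n F}"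
    using assms(2,3) by (rule bij_betw_biclosed_semigroup)
  fix C t m assume I: "t \<in> signed_indices n" "m \<in> signed_indices n" "t < m"
  \<comment> \<open>Hence \<open>F (t, m)\<close> and \<open>F (m, t)\<close> record membership of
    the root and of its negative independently, and (a) to (d) are the four combinations.\<close>
  have "- root_label \<alpha> t m = root_label \<alpha> m t"
    using root_label_swap[of m t \<alpha>] I by (simp add: signed_indices_iff)
  then show "({root_label \<alpha> t m, - root_label \<alpha> t m} \<inter> C = {}) =
      (biclosed_semigroup \<alpha> n C (t, m) = t \<and> biclosed_semigroup \<alpha> n C (m, t) = m)"
    "(root_label \<alpha> t m \<in> C \<and> - root_label \<alpha> t m \<notin> C) =
      (biclosed_semigroup \<alpha> n C (t, m) = m \<and> biclosed_semigroup \<alpha> n C (m, t) = m)"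
    "(- root_label \<alpha> t m \<in> C \<and> root_label \<alpha> t m \<notin> C) =
      (biclosed_semigroup \<alpha> n C (t, m) = t \<and> biclosed_semigroup \<alpha> n C (m, t) = t)"
    "({root_label \<alpha> t m, - root_label \<alpha> t m} \<subseteq> C) =
      (biclosed_semigroup \<alpha> n C (t, m) = m \<and> biclosed_semigroup \<alpha> n C (m, t) = t)"
    using I by (auto simp: biclosed_semigroup_apply)
qed

end
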